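(* Let $X$ be a length metric space and let $p,q,s\in X$ and $x\in[qs]\setminus\{q,s\}$, where $[qs]$ is a minimal geodesic, with $|qx|=b$ and $|xs|=d$. If there are $\kappa_1,\kappa_2\in\mathbb R$ such that $$\tilde\angle_{\kappa_1}(x;p,q)+\tilde\angle_{\kappa_2}(x;p,s)\le\pi,$$ then there is $\lambda\in(0,1)$ such that for $\bar\kappa=(1-\lambda)\kappa_1+\lambda\kappa_2$ we have $$\tilde\angle_{\kappa_1}(q;p,x)\ge\tilde\angle_{\bar\kappa}(q;p,s).$$
   Context: $|xy|$ denotes distance. $\tilde\angle_\kappa(q;p,s)$ is the angle at the vertex corresponding to $q$ of the triangle in the simply connected surface $\mathbb M^2_\kappa$ of constant curvature $\kappa$ with side lengths $|pq|,|qs|,|ps|$. Standing assumption: for each positive curvature parameter $\kappa$ involved, all triangles are contained in a ball of radius $\frac{\pi}{10\sqrt\kappa}$. *)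

theory Defs
  imports "HOL-Analysis.Analysis"
begin

section \<open>Length spaces and minimal geodesics\<close>

definition curve_length :: "(real \<Rightarrow> 'a::metric_space) \<Rightarrow> ennreal" where
  "curve_length g =
     (SUP ts \<in> {ts. sorted ts \<and> set ts \<subseteq> {0..1}}.
        ennreal (\<Sum>i<length ts - 1. dist (g (ts ! i)) (g (ts ! Suc i))))"

definition length_space :: "'a::metric_space itself \<Rightarrow> bool" where
  "length_space _ \<longleftrightarrow>
     (\<forall>x y :: 'a. ennreal (dist x y) =
        (INF g \<in> {g. path g \<and> pathstart g = x \<and> pathfinish g = y}. curve_length g))"

text \<open>Any parametrization on \<open>[0,1]\<close> is allowed, not only the one proportional to arc length.\<close>

definition minimal_geodesic :: "(real \<Rightarrow> 'a::metric_space) \<Rightarrow> 'a \<Rightarrow> 'a \<Rightarrow> bool" where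
  "minimal_geodesic g x y \<longleftrightarrow>
     path g \<and> pathstart g = x \<and> pathfinish g = y \<and> curve_length g = ennreal (dist x y)"

section \<open>The simply connected surface of constant curvature\<close>

text \<open>
  The surface is realized in \<open>\<real>\<^sup>3\<close>: for \<open>\<kappa> > 0\<close> as the round sphere of radius \<open>1 / sqrt \<kappa>\<close>, for
  \<open>\<kappa> = 0\<close> as a Euclidean plane, and for \<open>\<kappa> < 0\<close> as the upper sheet of the hyperboloid
  \<open>\<langle>v,v\<rangle> = 1 / \<kappa>\<close> in Minkowski space. The Riemannian metric is in each case the restriction of the
  bilinear form below to the tangent planes.
\<close>

definition model_form :: "real \<Rightarrow> real^3 \<Rightarrow> real^3 \<Rightarrow> real" where
  "model_form \<kappa> u v = u$1 * v$1 + u$2 * v$2 + sgn \<kappa> * (u$3 * v$3)"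

definition model_surface :: "real \<Rightarrow> (real^3) set" where
  "model_surface \<kappa> =
     (if \<kappa> > 0 then {v. model_form \<kappa> v v = 1 / \<kappa>}
      else if \<kappa> = 0 then {v. v$3 = 0}
      else {v. model_form \<kappa> v v = 1 / \<kappa> \<and> v$3 > 0})"

definition model_dist :: "real \<Rightarrow> real^3 \<Rightarrow> real^3 \<Rightarrow> real" where
  "model_dist \<kappa> u v =
     (if \<kappa> > 0 then arccos (\<kappa> * model_form \<kappa> u v) / sqrt \<kappa>
      else if \<kappa> = 0 then dist u v
      else arcosh (\<kappa> * model_form \<kappa> u v) / sqrt (- \<kappa>))"

text \<open>
  A positive multiple of the initial velocity at \<open>u\<close> of the geodesic from \<open>u\<close> to \<open>v\<close>: for
  \<open>\<kappa> \<noteq> 0\<close> it is the component of \<open>v\<close> orthogonal to \<open>u\<close>. It vanishes if \<open>v = u\<close>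
  (or if \<open>v\<close> is antipodal to \<open>u\<close>, when the geodesic is not unique).
\<close>

definition model_direction :: "real \<Rightarrow> real^3 \<Rightarrow> real^3 \<Rightarrow> real^3" where
  "model_direction \<kappa> u v =
     (if \<kappa> = 0 then v - u else v - (\<kappa> * model_form \<kappa> u v) *\<^sub>R u)"

text \<open>
  The angle at \<open>u\<close> between the geodesics from \<open>u\<close> to \<open>v\<close> and from \<open>u\<close> to \<open>w\<close>. If one of the
  directions vanishes, then the value is \<open>arccos 0 = pi / 2\<close>.
\<close>

definition model_angle :: "real \<Rightarrow> real^3 \<Rightarrow> real^3 \<Rightarrow> real^3 \<Rightarrow> real" where
  "model_angle \<kappa> u v w =
     (let a = model_direction \<kappa> u v; b = model_direction \<kappa> u w in
        arccos (model_form \<kappa> a b / (sqrt (model_form \<kappa> a a) * sqrt (model_form \<kappa> b b))))"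

section \<open>Comparison angles\<close>

text \<open>
  The first point is the vertex. The value is unspecified if there is no comparison triangle, which
  can happen only for \<open>\<kappa> > 0\<close> and is excluded there by the bound on the size of triangles.
\<close>

definition comparison_angle :: "real \<Rightarrow> 'a::metric_space \<Rightarrow> 'a \<Rightarrow> 'a \<Rightarrow> real" where
  "comparison_angle \<kappa> q p s =
     (THE \<theta>. \<exists>Q\<in>model_surface \<kappa>. \<exists>P\<in>model_surface \<kappa>. \<exists>S\<in>model_surface \<kappa>.
        model_dist \<kappa> P Q = dist p q \<and> model_dist \<kappa> Q S = dist q s \<and>
        model_dist \<kappa> P S = dist p s \<and> \<theta> = model_angle \<kappa> Q P S)"

definition in_small_ball :: "real \<Rightarrow> 'a::metric_space set \<Rightarrow> bool" where
  "in_small_ball \<kappa> T \<longleftrightarrow> (\<exists>c. T \<subseteq> cball c (pi / (10 * sqrt \<kappa>)))"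

end

theory Submission
  imports Defs
begin

text \<open>
  The whole argument takes place at the level of cosines. Write \<open>sn\<close>, \<open>cs\<close>, \<open>md\<close> for the sine, cosine
  and versed sine of curvature \<open>\<kappa>\<close>; the law of cosines then has one shape for all signs of \<open>\<kappa>\<close>, and
  a comparison angle is the arc cosine of the rational expression \<open>model_cos\<close> in these functions of
  the side lengths (\<open>comparison_angle_eq\<close>). Let \<open>a = |qp|\<close>, \<open>m = |xp|\<close>, \<open>c = |ps|\<close>. The hypothesis on
  the angles says that the cosines of the two angles at \<open>x\<close> have a nonnegative sum.

  Three facts carry the proof. First, for one fixed curvature the sum of the cosines at \<open>x\<close> and the
  difference of the cosines at \<open>q\<close> of the large and the small triangle differ by a positive factor
  (\<open>alexandrov_identity\<close>, an algebraic form of Alexandrov's lemma). Second, for fixed sides the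
  cosine decreases in the curvature, strictly if the triangle is nondegenerate
  (\<open>model_cos_antimono\<close>, \<open>model_cos_strict_antimono\<close>). Third, it is continuous in the curvature.

  Let \<open>\<kappa> = min \<kappa>\<^sub>1 \<kappa>\<^sub>2\<close>. Passing from \<open>\<kappa>\<^sub>1\<close> and \<open>\<kappa>\<^sub>2\<close> to \<open>\<kappa>\<close> only increases the cosines at \<open>x\<close>, so
  their sum stays nonnegative, and Alexandrov's lemma in curvature \<open>\<kappa>\<close> bounds the angle of the
  triangle \<open>q p s\<close> at \<open>q\<close> by that of \<open>q p x\<close>, which in turn is at most its value in curvature \<open>\<kappa>\<^sub>1\<close>. This
  is the assertion with \<open>\<kappa>\<close> in place of an interior point of the segment from \<open>\<kappa>\<^sub>1\<close> to \<open>\<kappa>\<^sub>2\<close>. If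
  \<open>\<kappa>\<^sub>1 = \<kappa>\<^sub>2\<close>, there is nothing left to do, and if the triangle \<open>q p s\<close> is degenerate, its angle does not
  depend on the curvature. Otherwise the sum of the cosines at \<open>x\<close> in curvature \<open>\<kappa>\<close> is strictly
  positive (\<open>cos_sum_pos\<close>), so the inequality is strict at \<open>\<kappa>\<close> and by continuity persists for
  interior points of the segment close to \<open>\<kappa>\<close>.
\<close>

section \<open>Trigonometry uniform in the curvature\<close>

definition sn :: "real \<Rightarrow> real \<Rightarrow> real" where
  "sn \<kappa> t =
     (if \<kappa> > 0 then sin (sqrt \<kappa> * t) / sqrt \<kappa>
      else if \<kappa> = 0 then t
      else sinh (sqrt (- \<kappa>) * t) / sqrt (- \<kappa>))"

definition cs :: "real \<Rightarrow> real \<Rightarrow> real" where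
  "cs \<kappa> t =
     (if \<kappa> > 0 then cos (sqrt \<kappa> * t)
      else if \<kappa> = 0 then 1
      else cosh (sqrt (- \<kappa>) * t))"

text \<open>
  The generalized versed sine \<open>(1 - cs \<kappa> t) / \<kappa>\<close>, in a form that also makes sense for \<open>\<kappa> = 0\<close>,
  where it is \<open>t\<^sup>2 / 2\<close>.
\<close>

definition md :: "real \<Rightarrow> real \<Rightarrow> real" where
  "md \<kappa> t = 2 * (sn \<kappa> (t / 2))\<^sup>2"

lemma sn_0 [simp]: "sn \<kappa> 0 = 0"
  by (simp add: sn_def)

lemma sn_minus: "sn \<kappa> (- t) = - sn \<kappa> t"
  by (simp add: sn_def)

lemma sn_add: "sn \<kappa> (a + b) = sn \<kappa> a * cs \<kappa> b + cs \<kappa> a * sn \<kappa> b"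
  by (auto simp: sn_def cs_def sin_add sinh_add distrib_left add_divide_distrib)

lemma cs_squared: "(cs \<kappa> t)\<^sup>2 = 1 - \<kappa> * (sn \<kappa> t)\<^sup>2"
proof -
  have "(cosh y)\<^sup>2 = 1 + (sinh y)\<^sup>2" for y :: real
    using cosh_square_eq[of y] by simp
  then show ?thesis
    by (auto simp: sn_def cs_def power_divide cos_squared_eq)
qed

lemma cs_add: "cs \<kappa> (a + b) = cs \<kappa> a * cs \<kappa> b - \<kappa> * sn \<kappa> a * sn \<kappa> b"
proof -
  have "\<kappa> = - (sqrt (- \<kappa>) * sqrt (- \<kappa>))" if "\<kappa> < 0"
    using that by simp
  then show ?thesis
    by (auto simp: sn_def cs_def cos_add cosh_add distrib_left)
qed

lemma cs_eq_md: "cs \<kappa> t = 1 - \<kappa> * md \<kappa> t"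
  using cs_add[of \<kappa> "t / 2" "t / 2"] cs_squared[of \<kappa> "t / 2"]
  by (simp add: md_def power2_eq_square)

lemma sn_squared: "(sn \<kappa> t)\<^sup>2 = 2 * md \<kappa> t - \<kappa> * (md \<kappa> t)\<^sup>2"
proof -
  have "sn \<kappa> t = 2 * sn \<kappa> (t / 2) * cs \<kappa> (t / 2)"
    using sn_add[of \<kappa> "t / 2" "t / 2"] by simp
  then show ?thesis
    using cs_squared[of \<kappa> "t / 2"] unfolding md_def by algebra
qed

lemma md_add: "md \<kappa> (a + b) = md \<kappa> a + md \<kappa> b - \<kappa> * md \<kappa> a * md \<kappa> b + sn \<kappa> a * sn \<kappa> b"
  using sn_add[of \<kappa> "a / 2" "b / 2"] sn_add[of \<kappa> "a / 2" "a / 2"] sn_add[of \<kappa> "b / 2" "b / 2"]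
    cs_squared[of \<kappa> "a / 2"] cs_squared[of \<kappa> "b / 2"]
  by (simp add: md_def add_divide_distrib) algebra

lemma md_minus: "md \<kappa> (- t) = md \<kappa> t"
  by (simp add: md_def sn_minus)

lemma md_0 [simp]: "md \<kappa> 0 = 0"
  by (simp add: md_def)

lemma md_diff: "md \<kappa> (a - b) = md \<kappa> a + md \<kappa> b - \<kappa> * md \<kappa> a * md \<kappa> b - sn \<kappa> a * sn \<kappa> b"
  using md_add[of \<kappa> a "- b"] by (simp add: md_minus sn_minus)

text \<open>
  The condition that \<open>t\<close> lies below the diameter \<open>pi / sqrt \<kappa>\<close> of the sphere is used in the form
  \<open>\<kappa> * t\<^sup>2 < pi\<^sup>2\<close>, which is automatic for \<open>\<kappa> \<le> 0\<close> and so avoids a case distinction.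
\<close>

lemma sqrt_mult_less_pi_iff:
  assumes "\<kappa> > 0" "t \<ge> 0"
  shows "sqrt \<kappa> * t < pi \<longleftrightarrow> \<kappa> * t\<^sup>2 < pi\<^sup>2"
  using assms real_sqrt_less_iff[of "\<kappa> * t\<^sup>2" "pi\<^sup>2"] by (simp add: real_sqrt_mult)

lemma sn_pos:
  assumes "t > 0" "\<kappa> * t\<^sup>2 < pi\<^sup>2"
  shows "sn \<kappa> t > 0"
  using assms sqrt_mult_less_pi_iff[of \<kappa> t] by (auto simp: sn_def intro!: sin_gt_zero divide_pos_pos)

lemma size_bound_mono:
  fixes \<kappa> t u :: real
  assumes "\<kappa> * u\<^sup>2 < pi\<^sup>2" "0 \<le> t" "t \<le> u" "\<kappa>' \<le> \<kappa>"
  shows "\<kappa>' * t\<^sup>2 < pi\<^sup>2"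
proof (cases "\<kappa>' \<le> 0")
  case True
  then have "\<kappa>' * t\<^sup>2 \<le> 0" by (simp add: mult_nonpos_nonneg)
  then show ?thesis using pi_gt_zero by (smt (verit) zero_less_power)
next
  case False
  have "t\<^sup>2 \<le> u\<^sup>2" using assms by (simp add: power_mono)
  then have "\<kappa>' * t\<^sup>2 \<le> \<kappa> * u\<^sup>2" using False assms by (intro mult_mono) auto
  then show ?thesis using assms by simp
qed

text \<open>
  At curvature \<open>0\<close> this is the limit \<open>sin (h * t) / h \<longlongrightarrow> t\<close>, and likewise for \<open>sinh\<close>, along
  \<open>h = sqrt \<bar>\<kappa>\<bar>\<close>.
\<close>

lemma isCont_sn: "isCont (\<lambda>\<kappa>. sn \<kappa> t) \<kappa>"
proof -
  consider "\<kappa> > 0" | "\<kappa> < 0" | "\<kappa> = 0" by linarith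
  then show ?thesis
  proof cases
    case 1
    have "isCont (\<lambda>\<kappa>. sin (sqrt \<kappa> * t) / sqrt \<kappa>) \<kappa>"
      using 1 by (intro continuous_intros) auto
    moreover have "\<forall>\<^sub>F k in nhds \<kappa>. sn k t = sin (sqrt k * t) / sqrt k"
      using eventually_nhds_in_open[of "{0<..}" \<kappa>] 1 by (auto elim!: eventually_mono simp: sn_def)
    ultimately show ?thesis by (subst isCont_cong)
  next
    case 2
    have "isCont (\<lambda>\<kappa>. sinh (sqrt (- \<kappa>) * t) / sqrt (- \<kappa>)) \<kappa>"
      using 2 by (intro continuous_intros) auto
    moreover have "\<forall>\<^sub>F k in nhds \<kappa>. sn k t = sinh (sqrt (- k) * t) / sqrt (- k)"
      using eventually_nhds_in_open[of "{..<0}" \<kappa>] 2 by (auto elim!: eventually_mono simp: sn_def)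
    ultimately show ?thesis by (subst isCont_cong)
  next
    case 3
    have sqrt0: "filterlim sqrt (at 0) (at_right 0)"
      by (rule filterlim_atI) (auto intro!: tendsto_eq_intros eventually_at_rightI[of 0 1])
    have "((\<lambda>h. sin (h * t)) has_field_derivative t) (at 0)"
      by (auto intro!: derivative_eq_intros)
    then have "((\<lambda>h. sin (h * t) / h) \<longlongrightarrow> t) (at 0)"
      by (simp add: DERIV_def)
    then have "((\<lambda>k. sin (sqrt k * t) / sqrt k) \<longlongrightarrow> t) (at_right 0)"
      by (rule filterlim_compose) (rule sqrt0)
    then have "((\<lambda>k. sn k t) \<longlongrightarrow> t) (at_right 0)"
      by (rule Lim_transform_eventually)
         (auto simp: sn_def intro!: eventually_at_rightI[of 0 1])
    moreover have "((\<lambda>h. sinh (h * t)) has_field_derivative t) (at 0)"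
      by (auto intro!: derivative_eq_intros)
    then have "((\<lambda>h. sinh (h * t) / h) \<longlongrightarrow> t) (at 0)"
      by (simp add: DERIV_def)
    then have "((\<lambda>k. sinh (sqrt k * t) / sqrt k) \<longlongrightarrow> t) (at_right 0)"
      by (rule filterlim_compose) (rule sqrt0)
    then have "((\<lambda>k. sinh (sqrt (- k) * t) / sqrt (- k)) \<longlongrightarrow> t) (at_left 0)"
      by (simp add: filterlim_at_left_to_right[of _ _ 0])
    then have "((\<lambda>k. sn k t) \<longlongrightarrow> t) (at_left 0)"
      by (rule Lim_transform_eventually)
         (auto simp: sn_def intro!: eventually_at_leftI[of "-1" 0])
    ultimately show ?thesis
      using 3 by (simp add: isCont_def filterlim_split_at sn_def)
  qed
qed

section \<open>The law of cosines and the half-angle formulas\<close>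

text \<open>
  The law of cosines solved for the cosine of the angle between the sides \<open>u\<close> and \<open>v\<close> opposite to
  \<open>w\<close>. For \<open>\<kappa> \<noteq> 0\<close> the numerator is \<open>(cs \<kappa> w - cs \<kappa> u * cs \<kappa> v) / \<kappa>\<close>. If \<open>u\<close> or \<open>v\<close> vanishes, then the
  value is \<open>0\<close> because of the division by zero, in agreement with the value \<open>pi / 2\<close> of \<open>model_angle\<close>
  in that case.
\<close>

definition model_cos :: "real \<Rightarrow> real \<Rightarrow> real \<Rightarrow> real \<Rightarrow> real" where
  "model_cos \<kappa> u v w =
     (md \<kappa> u + md \<kappa> v - md \<kappa> w - \<kappa> * md \<kappa> u * md \<kappa> v) / (sn \<kappa> u * sn \<kappa> v)"

lemma isCont_model_cos:
  assumes "sn \<kappa> u \<noteq> 0" "sn \<kappa> v \<noteq> 0"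
  shows "isCont (\<lambda>\<kappa>. model_cos \<kappa> u v w) \<kappa>"
  unfolding model_cos_def md_def using assms by (intro continuous_intros isCont_sn) auto

text \<open>
  The triangle inequalities together with, for \<open>\<kappa> > 0\<close>, a perimeter below that of a great circle.
  The inequalities make the sides nonnegative.
\<close>

definition has_triangle :: "real \<Rightarrow> real \<Rightarrow> real \<Rightarrow> real \<Rightarrow> bool" where
  "has_triangle \<kappa> u v w \<longleftrightarrow>
     u \<le> v + w \<and> v \<le> u + w \<and> w \<le> u + v \<and> \<kappa> * ((u + v + w) / 2)\<^sup>2 < pi\<^sup>2"

lemma md_sum_minus_md_diff: "md \<kappa> (a + b) - md \<kappa> (a - b) = 2 * sn \<kappa> a * sn \<kappa> b"
  by (simp add: md_add md_diff)

text \<open>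
  The half-angle formulas. With the sides written as \<open>y + z\<close>, \<open>x + z\<close>, \<open>x + y\<close>, the semiperimeter is
  \<open>x + y + z\<close> and the triangle inequalities say that \<open>x\<close>, \<open>y\<close>, \<open>z\<close> are nonnegative; this turns
  everything about the sign and size of the cosine into the positivity of \<open>sn\<close>.
\<close>

lemma one_minus_model_cos:
  assumes "sn \<kappa> (y + z) \<noteq> 0" "sn \<kappa> (x + z) \<noteq> 0"
  shows "1 - model_cos \<kappa> (y + z) (x + z) (x + y) =
           2 * sn \<kappa> x * sn \<kappa> y / (sn \<kappa> (y + z) * sn \<kappa> (x + z))"
  using assms md_sum_minus_md_diff[of \<kappa> x y] md_diff[of \<kappa> "x + z" "y + z"]
  by (simp add: model_cos_def field_simps)

lemma one_plus_model_cos: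
  assumes "sn \<kappa> (y + z) \<noteq> 0" "sn \<kappa> (x + z) \<noteq> 0"
  shows "1 + model_cos \<kappa> (y + z) (x + z) (x + y) =
           2 * sn \<kappa> (x + y + z) * sn \<kappa> z / (sn \<kappa> (y + z) * sn \<kappa> (x + z))"
proof -
  have "md \<kappa> (x + z + (y + z)) - md \<kappa> (x + y) = 2 * sn \<kappa> (x + y + z) * sn \<kappa> z"
    using md_sum_minus_md_diff[of \<kappa> "x + y + z" z] by (simp add: algebra_simps)
  then show ?thesis
    using assms md_add[of \<kappa> "x + z" "y + z"] by (simp add: model_cos_def field_simps)
qed

lemma has_triangleE:
  assumes "has_triangle \<kappa> u v w"
  obtains x y z where "x \<ge> 0" "y \<ge> 0" "z \<ge> 0" "u = y + z" "v = x + z" "w = x + y"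
    "\<kappa> * (x + y + z)\<^sup>2 < pi\<^sup>2"
proof
  show "\<kappa> * ((v + w - u) / 2 + (u + w - v) / 2 + (u + v - w) / 2)\<^sup>2 < pi\<^sup>2"
    using assms unfolding has_triangle_def by (simp add: field_simps)
qed (use assms in \<open>auto simp: has_triangle_def field_simps\<close>)

lemma has_triangle_antimono:
  assumes "has_triangle \<kappa> u v w" "\<kappa>' \<le> \<kappa>"
  shows "has_triangle \<kappa>' u v w"
  using assms size_bound_mono[of \<kappa> "(u + v + w) / 2" "(u + v + w) / 2" \<kappa>']
  by (auto simp: has_triangle_def)

text \<open>
  By the half-angle formulas, \<open>1 - model_cos\<close> and \<open>1 + model_cos\<close> are, up to positive factors,
  products of nonnegative values of \<open>sn\<close>, which vanish exactly if one of the triangle inequalities is an equality. Hence the cosine of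
  a degenerate triangle does not depend on the curvature.
\<close>

lemma
  assumes "has_triangle \<kappa> u v w"
  shows model_cos_le_1: "model_cos \<kappa> u v w \<le> 1" and model_cos_ge_minus_1: "-1 \<le> model_cos \<kappa> u v w"
    and model_cos_eq_1_iff: "u > 0 \<Longrightarrow> v > 0 \<Longrightarrow> model_cos \<kappa> u v w = 1 \<longleftrightarrow> w = \<bar>u - v\<bar>"
    and model_cos_eq_minus_1_iff: "u > 0 \<Longrightarrow> v > 0 \<Longrightarrow> model_cos \<kappa> u v w = -1 \<longleftrightarrow> w = u + v"
proof -
  obtain x y z where h: "x \<ge> 0" "y \<ge> 0" "z \<ge> 0" "u = y + z" "v = x + z" "w = x + y"
    "\<kappa> * (x + y + z)\<^sup>2 < pi\<^sup>2"
    using has_triangleE[OF assms] .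
  have sn0: "sn \<kappa> t \<ge> 0" "sn \<kappa> t = 0 \<longleftrightarrow> t = 0" if "0 \<le> t" "t \<le> x + y + z" for t
    using sn_pos[of t \<kappa>] size_bound_mono[OF h(7) that order_refl] that by (cases "t = 0"; simp)+
  have *: "model_cos \<kappa> u v w \<le> 1 \<and> -1 \<le> model_cos \<kappa> u v w \<and>
     (model_cos \<kappa> u v w = 1 \<longleftrightarrow> x = 0 \<or> y = 0) \<and> (model_cos \<kappa> u v w = -1 \<longleftrightarrow> z = 0)"
    if "u > 0" "v > 0"
  proof -
    have n: "sn \<kappa> (y + z) \<noteq> 0" "sn \<kappa> (x + z) \<noteq> 0"
      using that h sn0 by auto
    have "1 - model_cos \<kappa> u v w \<ge> 0" "1 + model_cos \<kappa> u v w \<ge> 0"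
      unfolding h one_minus_model_cos[OF n] one_plus_model_cos[OF n] using h
      by (auto intro!: divide_nonneg_nonneg mult_nonneg_nonneg sn0)
    moreover have "1 - model_cos \<kappa> u v w = 0 \<longleftrightarrow> x = 0 \<or> y = 0"
      unfolding h one_minus_model_cos[OF n] using h n sn0(2)[of x] sn0(2)[of y] by auto
    moreover have "1 + model_cos \<kappa> u v w = 0 \<longleftrightarrow> z = 0"
      unfolding h one_plus_model_cos[OF n] using h n that sn0(2)[of z] sn0(2)[of "x + y + z"] by auto
    ultimately show ?thesis by linarith
  qed
  have "model_cos \<kappa> u v w = 0" if "u = 0 \<or> v = 0"
    using that by (auto simp: model_cos_def)
  then show "model_cos \<kappa> u v w \<le> 1" "-1 \<le> model_cos \<kappa> u v w"
    using * h by fastforce+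
  show "model_cos \<kappa> u v w = 1 \<longleftrightarrow> w = \<bar>u - v\<bar>" if "u > 0" "v > 0"
    using *[OF that] h by auto
  show "model_cos \<kappa> u v w = -1 \<longleftrightarrow> w = u + v" if "u > 0" "v > 0"
    using *[OF that] h by auto
qed

section \<open>Comparison angles in the model surface\<close>

lemma model_form_commute: "model_form \<kappa> u v = model_form \<kappa> v u"
  by (simp add: model_form_def mult.commute)

lemma model_dist_commute: "model_dist \<kappa> u v = model_dist \<kappa> v u"
  by (simp add: model_dist_def model_form_commute dist_commute)

lemma model_form_sphere_bounds:
  assumes "\<kappa> > 0" "u \<in> model_surface \<kappa>" "v \<in> model_surface \<kappa>"
  shows "\<bar>\<kappa> * model_form \<kappa> u v\<bar> \<le> 1"
proof -
  have e: "model_form \<kappa> a b = a \<bullet> b" for a b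
    using assms by (simp add: model_form_def inner_vec_def sum_3)
  have "norm a = sqrt (1 / \<kappa>)" if "a \<in> model_surface \<kappa>" for a
    using that assms by (simp add: model_surface_def e norm_eq_sqrt_inner)
  then have "\<bar>u \<bullet> v\<bar> \<le> sqrt (1 / \<kappa>) * sqrt (1 / \<kappa>)"
    using Cauchy_Schwarz_ineq2[of u v] assms by simp
  then show ?thesis using assms by (simp add: e abs_mult field_simps)
qed

text \<open>
  The reversed Cauchy--Schwarz inequality for vectors in the same sheet of the hyperboloid.
\<close>

lemma model_form_hyperboloid_ge_1:
  assumes "\<kappa> < 0" "u \<in> model_surface \<kappa>" "v \<in> model_surface \<kappa>"
  shows "\<kappa> * model_form \<kappa> u v \<ge> 1"
proof -
  let ?r = "- 1 / \<kappa>"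
  have r: "?r > 0" using assms by (simp add: divide_neg_neg)
  have sheet: "a$3 > 0" "(a$3)\<^sup>2 = (a$1)\<^sup>2 + (a$2)\<^sup>2 + ?r" if "a \<in> model_surface \<kappa>" for a
    using that assms by (auto simp: model_surface_def model_form_def power2_eq_square)
  let ?i = "u$1 * v$1 + u$2 * v$2"
  have "(?i + ?r)\<^sup>2 \<le> (u$3 * v$3)\<^sup>2"
  proof -
    \<comment> \<open>The difference is Lagrange's identity plus the contribution of the defect \<open>?r\<close>.\<close>
    have "(u$3 * v$3)\<^sup>2 - (?i + ?r)\<^sup>2 =
      (u$1 * v$2 - u$2 * v$1)\<^sup>2 + ?r * ((u$1 - v$1)\<^sup>2 + (u$2 - v$2)\<^sup>2)"
      unfolding power_mult_distrib sheet(2)[OF assms(2)] sheet(2)[OF assms(3)]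
      by (simp only: power2_eq_square) algebra
    also have "\<dots> \<ge> 0" using r by (intro add_nonneg_nonneg mult_nonneg_nonneg) auto
    finally show ?thesis by simp
  qed
  then have "?i + ?r \<le> u$3 * v$3"
    by (rule power2_le_imp_le) (simp add: less_imp_le sheet(1)[OF assms(2)] sheet(1)[OF assms(3)])
  then have "\<kappa> * (?i - u$3 * v$3) \<ge> \<kappa> * (- ?r)"
    using assms by (intro mult_left_mono_neg) auto
  then show ?thesis using assms by (simp add: model_form_def)
qed

lemma cs_model_dist:
  assumes "\<kappa> \<noteq> 0" "u \<in> model_surface \<kappa>" "v \<in> model_surface \<kappa>"
  shows "cs \<kappa> (model_dist \<kappa> u v) = \<kappa> * model_form \<kappa> u v"
  using assms model_form_sphere_bounds[OF _ assms(2,3)] model_form_hyperboloid_ge_1[OF _ assms(2,3)]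
  by (auto simp: cs_def model_dist_def cosh_arcosh_real abs_le_iff cos_arccos)

lemma sn_model_dist_nonneg:
  assumes "u \<in> model_surface \<kappa>" "v \<in> model_surface \<kappa>"
  shows "sn \<kappa> (model_dist \<kappa> u v) \<ge> 0"
  using model_form_sphere_bounds[OF _ assms] model_form_hyperboloid_ge_1[OF _ assms]
  by (auto simp: sn_def model_dist_def abs_le_iff arccos_lbound arccos_ubound
      intro!: sin_ge_zero divide_nonneg_nonneg)

lemma md_eq_cs: "\<kappa> \<noteq> 0 \<Longrightarrow> md \<kappa> t = (1 - cs \<kappa> t) / \<kappa>"
  by (simp add: cs_eq_md)

lemma md_0_curvature: "md 0 t = t\<^sup>2 / 2"
  by (simp add: md_def sn_def power2_eq_square)

text \<open>
  The law of cosines on the model surface: for \<open>\<kappa> \<noteq> 0\<close> the component of \<open>v\<close> orthogonal to \<open>u\<close> and that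
  of \<open>w\<close> have the product \<open>\<langle>v,w\<rangle> - \<kappa> \<langle>u,v\<rangle> \<langle>u,w\<rangle>\<close>, and \<open>\<kappa> \<langle>u,v\<rangle>\<close> is \<open>cs\<close> of the distance; for
  \<open>\<kappa> = 0\<close> it is the polarization identity.
\<close>

lemma model_form_directions:
  assumes "u \<in> model_surface \<kappa>" "v \<in> model_surface \<kappa>" "w \<in> model_surface \<kappa>"
  shows "model_form \<kappa> (model_direction \<kappa> u v) (model_direction \<kappa> u w) =
    md \<kappa> (model_dist \<kappa> u v) + md \<kappa> (model_dist \<kappa> u w) - md \<kappa> (model_dist \<kappa> v w)
      - \<kappa> * md \<kappa> (model_dist \<kappa> u v) * md \<kappa> (model_dist \<kappa> u w)"
proof (cases "\<kappa> = 0")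
  case True
  have dist: "(dist a b)\<^sup>2 = (a$1 - b$1)\<^sup>2 + (a$2 - b$2)\<^sup>2"
    if "a \<in> model_surface 0" "b \<in> model_surface 0" for a b
    using that by (simp add: dist_vec_def L2_set_def sum_3 model_surface_def dist_real_def)
  have "(dist u v)\<^sup>2 + (dist u w)\<^sup>2 - (dist v w)\<^sup>2 =
      2 * ((v$1 - u$1) * (w$1 - u$1) + (v$2 - u$2) * (w$2 - u$2))"
    unfolding dist[OF assms(1,2)[unfolded True]] dist[OF assms(1,3)[unfolded True]]
      dist[OF assms(2,3)[unfolded True]] by algebra
  then show ?thesis
    by (simp add: True md_0_curvature model_dist_def model_direction_def model_form_def)
next
  case False
  have uu: "model_form \<kappa> u u = 1 / \<kappa>"
    using assms False by (auto simp: model_surface_def split: if_splits)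
  have "model_form \<kappa> (model_direction \<kappa> u v) (model_direction \<kappa> u w) =
    model_form \<kappa> v w - 2 * (\<kappa> * model_form \<kappa> u v * model_form \<kappa> u w)
     + (\<kappa> * model_form \<kappa> u v) * (\<kappa> * model_form \<kappa> u w) * model_form \<kappa> u u"
    using False by (simp add: model_direction_def model_form_def algebra_simps)
  also have "\<dots> = model_form \<kappa> v w - \<kappa> * model_form \<kappa> u v * model_form \<kappa> u w"
    using False by (simp add: uu)
  finally show ?thesis
    using False assms by (simp add: md_eq_cs cs_model_dist) (simp add: field_simps)
qed

lemma model_dist_self:
  assumes "v \<in> model_surface \<kappa>"
  shows "model_dist \<kappa> v v = 0"
  using assms by (auto simp: model_surface_def model_dist_def arcosh_1 split: if_splits)

text \<open>
  By the case \<open>v = w\<close> of the law of cosines, the length of the direction from \<open>u\<close> to a point at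
  distance \<open>r\<close> is \<open>sn \<kappa> r\<close>. Degenerate positions are included, since both sides divide by zero at
  the same places.
\<close>

lemma model_angle_eq:
  assumes "u \<in> model_surface \<kappa>" "v \<in> model_surface \<kappa>" "w \<in> model_surface \<kappa>"
  shows "model_angle \<kappa> u v w =
    arccos (model_cos \<kappa> (model_dist \<kappa> u v) (model_dist \<kappa> u w) (model_dist \<kappa> v w))"
proof -
  have "sqrt (model_form \<kappa> (model_direction \<kappa> u a) (model_direction \<kappa> u a)) = sn \<kappa> (model_dist \<kappa> u a)"
    if "a \<in> model_surface \<kappa>" for a
  proof -
    have "model_form \<kappa> (model_direction \<kappa> u a) (model_direction \<kappa> u a) = (sn \<kappa> (model_dist \<kappa> u a))\<^sup>2"
      using that assms
      by (simp add: model_form_directions model_dist_self sn_squared) (simp add: power2_eq_square)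
    then show ?thesis using sn_model_dist_nonneg[OF assms(1) that] by simp
  qed
  then show ?thesis
    using assms by (simp add: model_angle_def Let_def model_cos_def model_form_directions)
qed

text \<open>
  The point with geodesic polar coordinates \<open>(r, \<theta>)\<close> about the pole, which is \<open>(0, 0, 1 / sqrt \<bar>\<kappa>\<bar>)\<close> for
  \<open>\<kappa> \<noteq> 0\<close> and the origin for \<open>\<kappa> = 0\<close>.
\<close>

definition polar :: "real \<Rightarrow> real \<Rightarrow> real \<Rightarrow> real^3" where
  "polar \<kappa> r \<theta> = vector [sn \<kappa> r * cos \<theta>, sn \<kappa> r * sin \<theta>, if \<kappa> = 0 then 0 else cs \<kappa> r / sqrt \<bar>\<kappa>\<bar>]"

lemma model_form_polar:
  assumes "\<kappa> \<noteq> 0"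
  shows "\<kappa> * model_form \<kappa> (polar \<kappa> r \<theta>) (polar \<kappa> r' \<theta>') =
     \<kappa> * sn \<kappa> r * sn \<kappa> r' * cos (\<theta> - \<theta>') + cs \<kappa> r * cs \<kappa> r'"
proof -
  have "\<kappa> * (sgn \<kappa> * (cs \<kappa> r / sqrt \<bar>\<kappa>\<bar> * (cs \<kappa> r' / sqrt \<bar>\<kappa>\<bar>))) =
      (\<kappa> * sgn \<kappa>) * (cs \<kappa> r * cs \<kappa> r') / \<bar>\<kappa>\<bar>"
    by simp
  also have "\<dots> = cs \<kappa> r * cs \<kappa> r'"
    using assms by (simp add: sgn_if)
  finally show ?thesis
    using assms by (simp add: model_form_def polar_def cos_diff distrib_left)
qed

lemma polar_in_model_surface: "polar \<kappa> r \<theta> \<in> model_surface \<kappa>"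
proof (cases "\<kappa> = 0")
  case False
  have "\<kappa> * model_form \<kappa> (polar \<kappa> r \<theta>) (polar \<kappa> r \<theta>) = 1"
    using cs_squared[of \<kappa> r] by (simp add: model_form_polar[OF False] power2_eq_square)
  then have "model_form \<kappa> (polar \<kappa> r \<theta>) (polar \<kappa> r \<theta>) = 1 / \<kappa>"
    using False by (simp add: field_simps)
  moreover have "\<kappa> < 0 \<Longrightarrow> polar \<kappa> r \<theta> $ 3 > 0"
    by (simp add: polar_def cs_def)
  ultimately show ?thesis using False by (simp add: model_surface_def)
qed (simp add: model_surface_def polar_def)

lemma model_dist_polar:
  assumes "w \<ge> 0" "\<kappa> * w\<^sup>2 \<le> pi\<^sup>2"
    and law: "md \<kappa> r + md \<kappa> r' - md \<kappa> w - \<kappa> * md \<kappa> r * md \<kappa> r' = sn \<kappa> r * sn \<kappa> r' * cos (\<theta> - \<theta>')"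
  shows "model_dist \<kappa> (polar \<kappa> r \<theta>) (polar \<kappa> r' \<theta>') = w"
proof (cases "\<kappa> = 0")
  case True
  have "(dist (polar 0 r \<theta>) (polar 0 r' \<theta>'))\<^sup>2 =
     (r * cos \<theta> - r' * cos \<theta>')\<^sup>2 + (r * sin \<theta> - r' * sin \<theta>')\<^sup>2"
    by (simp add: dist_vec_def L2_set_def sum_3 dist_real_def polar_def sn_def)
  also have "\<dots> = r\<^sup>2 * ((cos \<theta>)\<^sup>2 + (sin \<theta>)\<^sup>2) + r'\<^sup>2 * ((cos \<theta>')\<^sup>2 + (sin \<theta>')\<^sup>2) - 2 * r * r' * cos (\<theta> - \<theta>')"
    unfolding cos_diff by algebra
  also have "\<dots> = w\<^sup>2"
    using law True by (simp add: md_0_curvature sn_def field_simps)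
  finally show ?thesis using True assms by (simp add: model_dist_def)
next
  case False
  have "cs \<kappa> w = cs \<kappa> r * cs \<kappa> r' + \<kappa> * (sn \<kappa> r * sn \<kappa> r' * cos (\<theta> - \<theta>'))"
    unfolding law[symmetric] cs_eq_md by (simp add: algebra_simps)
  then have e: "\<kappa> * model_form \<kappa> (polar \<kappa> r \<theta>) (polar \<kappa> r' \<theta>') = cs \<kappa> w"
    by (simp add: model_form_polar[OF False])
  have "sqrt \<kappa> * w \<le> pi" if "\<kappa> > 0"
    using that assms real_sqrt_le_iff[of "\<kappa> * w\<^sup>2" "pi\<^sup>2"] by (simp add: real_sqrt_mult)
  then show ?thesis
    using False assms(1) unfolding model_dist_def e
    by (auto simp: cs_def arccos_cos arcosh_cosh_real)
qed

text \<open>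
  Uniqueness of the value follows from the law of cosines on the surface. For existence, put the vertex
  at the pole and the other two points at the angles \<open>0\<close> and \<open>arccos (model_cos \<kappa> u v w)\<close> in polar
  coordinates.
\<close>

lemma comparison_angle_eq:
  assumes "has_triangle \<kappa> (dist q p) (dist q s) (dist p s)"
  shows "comparison_angle \<kappa> q p s = arccos (model_cos \<kappa> (dist q p) (dist q s) (dist p s))"
proof -
  define u v w where "u = dist q p" "v = dist q s" "w = dist p s"
  have t: "has_triangle \<kappa> u v w" using assms by (simp add: u_v_w_def)
  let ?\<theta> = "arccos (model_cos \<kappa> u v w)"
  have cos: "cos ?\<theta> = model_cos \<kappa> u v w"
    using model_cos_le_1[OF t] model_cos_ge_minus_1[OF t] by (simp add: cos_arccos)
  have small: "\<kappa> * r\<^sup>2 \<le> pi\<^sup>2" if "r \<in> {u, v, w}" for r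
    using size_bound_mono[of \<kappa> "(u + v + w) / 2" r \<kappa>] t that
    by (auto simp: has_triangle_def u_v_w_def intro!: less_imp_le)
  have n: "u \<ge> 0" "v \<ge> 0" "w \<ge> 0" by (auto simp: u_v_w_def)
  let ?Q = "polar \<kappa> 0 0" and ?P = "polar \<kappa> u 0" and ?S = "polar \<kappa> v ?\<theta>"
  have "model_dist \<kappa> ?Q ?P = u" "model_dist \<kappa> ?Q ?S = v"
    using n small by (auto intro!: model_dist_polar)
  moreover have "model_dist \<kappa> ?P ?S = w"
  proof (rule model_dist_polar)
    show "md \<kappa> u + md \<kappa> v - md \<kappa> w - \<kappa> * md \<kappa> u * md \<kappa> v = sn \<kappa> u * sn \<kappa> v * cos (0 - ?\<theta>)"
    proof (cases "u = 0 \<or> v = 0")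
      case True
      then have "w = v \<or> w = u" "u = 0 \<and> w = v \<or> v = 0 \<and> w = u"
        using t by (auto simp: has_triangle_def)
      then show ?thesis by auto
    next
      case False
      have "sn \<kappa> r \<noteq> 0" if "r \<in> {u, v}" for r
        using size_bound_mono[of \<kappa> "(u + v + w) / 2" r \<kappa>] sn_pos[of r \<kappa>] t that False n
        by (auto simp: has_triangle_def)
      then show ?thesis by (simp add: cos) (simp add: model_cos_def)
    qed
  qed (use n small in auto)
  ultimately have ex: "\<exists>Q\<in>model_surface \<kappa>. \<exists>P\<in>model_surface \<kappa>. \<exists>S\<in>model_surface \<kappa>.
     model_dist \<kappa> P Q = u \<and> model_dist \<kappa> Q S = v \<and> model_dist \<kappa> P S = w \<and>
     ?\<theta> = model_angle \<kappa> Q P S"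
    using polar_in_model_surface
    by (intro bexI[of _ ?Q] bexI[of _ ?P] bexI[of _ ?S]) (auto simp: model_angle_eq model_dist_commute)
  show ?thesis
    unfolding comparison_angle_def u_v_w_def[symmetric] dist_commute[of p q]
  proof (rule the_equality, rule ex)
    fix \<theta>
    assume "\<exists>Q\<in>model_surface \<kappa>. \<exists>P\<in>model_surface \<kappa>. \<exists>S\<in>model_surface \<kappa>.
       model_dist \<kappa> P Q = u \<and> model_dist \<kappa> Q S = v \<and> model_dist \<kappa> P S = w \<and> \<theta> = model_angle \<kappa> Q P S"
    then show "\<theta> = ?\<theta>" by (auto simp: model_angle_eq model_dist_commute)
  qed
qed

text \<open>
  The three-point subdivision through \<open>x\<close> already bounds the length of the curve from below by
  \<open>|qx| + |xs|\<close>.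
\<close>

lemma dist_add_of_minimal_geodesic:
  fixes q s x :: "'a::metric_space"
  assumes "minimal_geodesic g q s" "x \<in> path_image g"
  shows "dist q x + dist x s = dist q s"
proof -
  obtain t where t: "t \<in> {0..1}" "x = g t" using assms by (auto simp: path_image_def)
  have ends: "g 0 = q" "g 1 = s"
    using assms by (auto simp: minimal_geodesic_def pathstart_def pathfinish_def)
  let ?ts = "[0, t, 1]"
  have "ennreal (\<Sum>i<length ?ts - 1. dist (g (?ts ! i)) (g (?ts ! Suc i))) \<le> curve_length g"
    unfolding curve_length_def using t by (intro SUP_upper) auto
  also have "\<dots> = ennreal (dist q s)" using assms by (simp add: minimal_geodesic_def)
  also have "(\<Sum>i<length ?ts - 1. dist (g (?ts ! i)) (g (?ts ! Suc i))) = dist q x + dist x s"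
    by (simp add: t ends numeral_2_eq_2)
  finally have "dist q x + dist x s \<le> dist q s" by (simp only: ennreal_le_iff zero_le_dist)
  then show ?thesis using dist_triangle[of q s x] by simp
qed

lemma has_triangle_if_in_small_ball:
  assumes "\<kappa> > 0 \<Longrightarrow> in_small_ball \<kappa> {p, q, s}"
  shows "has_triangle \<kappa> (dist q p) (dist q s) (dist p s)"
proof -
  let ?h = "(dist q p + dist q s + dist p s) / 2"
  have "\<kappa> * ?h\<^sup>2 < pi\<^sup>2"
  proof (cases "\<kappa> > 0")
    case True
    then obtain c where c: "{p, q, s} \<subseteq> cball c (pi / (10 * sqrt \<kappa>))"
      using assms by (auto simp: in_small_ball_def)
    define r where "r = pi / (10 * sqrt \<kappa>)"
    have "dist c p \<le> r" "dist c q \<le> r" "dist c s \<le> r"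
      using c by (auto simp: r_def)
    then have "?h \<le> 3 * r"
      using dist_triangle3[of q p c] dist_triangle3[of q s c] dist_triangle3[of p s c] by simp
    also have "\<dots> < pi / sqrt \<kappa>" using True by (simp add: r_def field_simps)
    finally have "sqrt \<kappa> * ?h < pi" using True by (simp add: field_simps)
    then show ?thesis using sqrt_mult_less_pi_iff[OF True, of ?h] by simp
  next
    case False
    then have "\<kappa> * ?h\<^sup>2 \<le> 0" by (simp add: mult_nonpos_nonneg)
    then show ?thesis using pi_gt_zero by (smt (verit) zero_less_power)
  qed
  moreover have "dist q p \<le> dist q s + dist p s" "dist q s \<le> dist q p + dist p s" "dist p s \<le> dist q p + dist q s"
    by (metis dist_commute dist_triangle)+
  ultimately show ?thesis by (simp add: has_triangle_def)
qed

section \<open>Monotonicity in the curvature\<close>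

text \<open>
  If \<open>F t / t\<close> is positive and increasing, then \<open>F\<close> is positive and superadditive. Logarithmic
  differentiation reduces the monotonicity of comparison angles to this inequality for \<open>F t = t * J t\<close>, where \<open>F t\<close> is
  \<open>1 - t * cot t\<close> in positive and \<open>t * coth t - 1\<close> in negative curvature.
\<close>

lemma superadditive_of_increasing_quotient:
  fixes J :: "real \<Rightarrow> real"
  assumes pos: "\<And>t. 0 < t \<Longrightarrow> t \<le> x + y + z \<Longrightarrow> J t > 0"
    and mono: "\<And>t u. 0 < t \<Longrightarrow> t \<le> u \<Longrightarrow> u \<le> x + y + z \<Longrightarrow> J t \<le> J u"
    and xyz: "x > 0" "y > 0" "z > 0"
  shows "x * J x + y * J y < (x + y + z) * J (x + y + z) + z * J z"
proof -
  let ?s = "x + y + z"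
  have "x * J x + y * J y \<le> x * J ?s + y * J ?s"
    using xyz by (intro add_mono mult_left_mono mono) auto
  moreover have "0 < z * J ?s" "0 < z * J z"
    using xyz by (auto intro!: mult_pos_pos pos)
  ultimately show ?thesis by (simp add: algebra_simps)
qed

lemma cot_superadditive:
  assumes "x > 0" "y > 0" "z > 0" "x + y + z < pi"
  shows "(x + y + z) * cot (x + y + z) + z * cot z < x * cot x + y * cot y"
proof -
  define J :: "real \<Rightarrow> real" where "J t = 1 / t - cot t" for t
  have tJ: "t * J t = 1 - t * cot t" if "t > 0" for t
    using that by (simp add: J_def field_simps)
  have pos: "J t > 0" if "0 < t" "t < pi" for t
  proof -
    have "sin 0 - 0 * cos 0 < sin t - t * cos t"
    proof (rule DERIV_pos_imp_increasing_open[OF that(1)])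
      fix u assume u: "0 < u" "u < t"
      have "((\<lambda>t. sin t - t * cos t) has_real_derivative u * sin u) (at u)"
        by (auto intro!: derivative_eq_intros)
      moreover have "u * sin u > 0" using u that by (simp add: sin_gt_zero)
      ultimately show "\<exists>D. ((\<lambda>t. sin t - t * cos t) has_real_derivative D) (at u) \<and> 0 < D"
        by blast
    qed (intro continuous_intros)
    moreover have "sin t > 0" using that by (simp add: sin_gt_zero)
    ultimately show ?thesis using that by (simp add: J_def cot_def field_simps)
  qed
  have mono: "J t \<le> J u" if "0 < t" "t \<le> u" "u < pi" for t u
  proof (rule DERIV_nonneg_imp_nondecreasing[OF that(2)])
    fix w assume w: "t \<le> w" "w \<le> u"
    then have s: "0 < sin w" using that by (simp add: sin_gt_zero)
    have "sin w \<le> w" using w that by (simp add: sin_x_le_x)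
    then have "(sin w)\<^sup>2 \<le> w\<^sup>2" using s by (simp add: power_mono)
    then have "inverse (w\<^sup>2) \<le> inverse ((sin w)\<^sup>2)" using s by (simp add: le_imp_inverse_le)
    moreover have "(J has_real_derivative (inverse ((sin w)\<^sup>2) - inverse (w\<^sup>2))) (at w)"
      unfolding J_def using w that s
      by (auto intro!: derivative_eq_intros DERIV_cot simp: power2_eq_square inverse_eq_divide)
    ultimately show "\<exists>D. (J has_real_derivative D) (at w) \<and> 0 \<le> D"
      by (metis diff_ge_0_iff_ge)
  qed
  have "x * J x + y * J y < (x + y + z) * J (x + y + z) + z * J z"
    using assms by (intro superadditive_of_increasing_quotient pos mono) auto
  then show ?thesis using assms by (simp add: tJ)
qed

lemma coth_superadditive:
  fixes x y z :: real
  defines "coth \<equiv> \<lambda>t::real. cosh t / sinh t"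
  assumes "x > 0" "y > 0" "z > 0"
  shows "x * coth x + y * coth y < (x + y + z) * coth (x + y + z) + z * coth z"
proof -
  define J :: "real \<Rightarrow> real" where "J t = coth t - 1 / t" for t
  have tJ: "t * J t = t * coth t - 1" if "t > 0" for t
    using that by (simp add: J_def field_simps)
  have pos: "J t > 0" if "0 < t" for t
  proof -
    have "0 * cosh 0 - sinh 0 < t * cosh t - sinh t"
    proof (rule DERIV_pos_imp_increasing_open[OF that])
      fix u :: real assume u: "0 < u"
      have "((\<lambda>t. t * cosh t - sinh t) has_real_derivative u * sinh u) (at u)"
        by (auto intro!: derivative_eq_intros)
      then show "\<exists>D. ((\<lambda>t. t * cosh t - sinh t) has_real_derivative D) (at u) \<and> 0 < D"
        using u by (intro exI[of _ "u * sinh u"]) simp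
    qed (intro continuous_intros)
    then show ?thesis using that by (simp add: J_def coth_def field_simps)
  qed
  have le_sinh: "t \<le> sinh t" if "0 \<le> t" for t :: real
  proof -
    have "sinh 0 - 0 \<le> sinh t - t"
    proof (rule DERIV_nonneg_imp_nondecreasing[OF that])
      fix u :: real
      have "((\<lambda>t. sinh t - t) has_real_derivative cosh u - 1) (at u)"
        by (auto intro!: derivative_eq_intros)
      then show "\<exists>D. ((\<lambda>t. sinh t - t) has_real_derivative D) (at u) \<and> 0 \<le> D"
        by (intro exI[of _ "cosh u - 1"]) (simp add: cosh_real_ge_1)
    qed
    then show ?thesis by simp
  qed
  have mono: "J t \<le> J u" if "0 < t" "t \<le> u" for t u
  proof (rule DERIV_nonneg_imp_nondecreasing[OF that(2)])
    fix w assume w: "t \<le> w" "w \<le> u"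
    then have s: "0 < sinh w" using that by simp
    have "w\<^sup>2 \<le> (sinh w)\<^sup>2" using le_sinh w that by (simp add: power_mono)
    then have "inverse ((sinh w)\<^sup>2) \<le> inverse (w\<^sup>2)" using w that by (simp add: le_imp_inverse_le)
    moreover have "(sinh w * sinh w - cosh w * cosh w) / (sinh w * sinh w) = - inverse ((sinh w)\<^sup>2)"
      using cosh_square_eq[of w] by (simp add: power2_eq_square field_simps)
    then have "(J has_real_derivative (inverse (w\<^sup>2) - inverse ((sinh w)\<^sup>2))) (at w)"
      unfolding J_def coth_def using w that s
      by (auto intro!: derivative_eq_intros simp: power2_eq_square inverse_eq_divide)
    ultimately show "\<exists>D. (J has_real_derivative D) (at w) \<and> 0 \<le> D"
      by (metis diff_ge_0_iff_ge)
  qed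
  have "x * J x + y * J y < (x + y + z) * J (x + y + z) + z * J z"
    using assms by (intro superadditive_of_increasing_quotient pos mono) auto
  then show ?thesis using assms by (simp add: tJ)
qed

text \<open>
  The square of the tangent of half the angle, as the quotient of the two half-angle formulas. It is
  the most convenient function of the angle to differentiate, because the powers of \<open>sqrt \<bar>\<kappa>\<bar>\<close> in the
  denominators of \<open>sn\<close> cancel and its logarithm is a sum.
\<close>

definition tan_half_sq :: "real \<Rightarrow> real \<Rightarrow> real \<Rightarrow> real \<Rightarrow> real" where
  "tan_half_sq \<kappa> x y z = sn \<kappa> x * sn \<kappa> y / (sn \<kappa> (x + y + z) * sn \<kappa> z)"

context
  fixes x y z :: real
  assumes xyz: "x > 0" "y > 0" "z > 0"
begin

text \<open>
  Apart from a factor \<open>1 / k\<close>, the derivative of the logarithm with respect to \<open>k = sqrt \<kappa>\<close> is the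
  difference of the two sides of \<open>cot_superadditive\<close> at \<open>k * x\<close>, \<open>k * y\<close>, \<open>k * z\<close>. The negative
  case is analogous, with \<open>k = sqrt (- \<kappa>)\<close> decreasing in \<open>\<kappa>\<close>.
\<close>

lemma tan_half_sq_less_positive:
  assumes "0 < \<kappa>" "\<kappa> < \<kappa>'" "\<kappa>' * (x + y + z)\<^sup>2 < pi\<^sup>2"
  shows "tan_half_sq \<kappa> x y z < tan_half_sq \<kappa>' x y z"
proof -
  define L where "L k t = ln (sin (k * t))" for k t :: real
  define G where "G k = L k x + L k y - L k (x + y + z) - L k z" for k
  have small: "k * (x + y + z) < pi" if "k \<le> sqrt \<kappa>'" for k
  proof -
    have "k * (x + y + z) \<le> sqrt \<kappa>' * (x + y + z)" using that xyz by (intro mult_right_mono) auto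
    also have "\<dots> < pi" using assms sqrt_mult_less_pi_iff[of \<kappa>' "x + y + z"] xyz by simp
    finally show ?thesis .
  qed
  have sin_pos: "sin (k * t) > 0" if "0 < k" "k \<le> sqrt \<kappa>'" "0 < t" "t \<le> x + y + z" for k t
  proof (rule sin_gt_zero)
    have "k * t \<le> k * (x + y + z)" using that by simp
    then show "k * t < pi" using small[OF that(2)] by simp
  qed (use that in simp)
  have deriv: "((\<lambda>k. L k t) has_real_derivative t * cot (k * t)) (at k)"
    if "0 < k" "k \<le> sqrt \<kappa>'" "0 < t" "t \<le> x + y + z" for k t
    unfolding L_def using sin_pos[OF that]
    by (auto intro!: derivative_eq_intros simp: cot_def)
  have "G (sqrt \<kappa>) < G (sqrt \<kappa>')"
  proof (rule DERIV_pos_imp_increasing[where f = G])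
    fix k assume "sqrt \<kappa> \<le> k" "k \<le> sqrt \<kappa>'"
    moreover have "0 < sqrt \<kappa>" using assms by simp
    ultimately have k: "0 < k" "k \<le> sqrt \<kappa>'" by linarith+
    let ?D = "x * cot (k * x) + y * cot (k * y) - (x + y + z) * cot (k * (x + y + z)) - z * cot (k * z)"
    have "(G has_real_derivative ?D) (at k)"
      unfolding G_def using k xyz by (intro derivative_intros deriv) auto
    moreover have "k * ?D > 0"
      using cot_superadditive[of "k * x" "k * y" "k * z"] k xyz small[OF k(2)]
      by (simp add: algebra_simps)
    then have "?D > 0" using k by (simp add: zero_less_mult_iff)
    ultimately show "\<exists>D. (G has_real_derivative D) (at k) \<and> 0 < D" by blast
  qed (use assms in simp)
  moreover have "tan_half_sq k x y z = exp (G (sqrt k))" if "0 < k" "k \<le> \<kappa>'" for k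
    using sin_pos[of "sqrt k"] that xyz
    by (simp add: tan_half_sq_def sn_def G_def L_def exp_add exp_diff)
  ultimately show ?thesis using assms by simp
qed

lemma tan_half_sq_less_negative:
  assumes "\<kappa> < \<kappa>'" "\<kappa>' < 0"
  shows "tan_half_sq \<kappa> x y z < tan_half_sq \<kappa>' x y z"
proof -
  define L where "L k t = ln (sinh (k * t))" for k t :: real
  define G where "G k = L k x + L k y - L k (x + y + z) - L k z" for k
  have deriv: "((\<lambda>k. L k t) has_real_derivative t * (cosh (k * t) / sinh (k * t))) (at k)"
    if "0 < k" "0 < t" for k t
    unfolding L_def using that by (auto intro!: derivative_eq_intros)
  have "G (sqrt (- \<kappa>)) < G (sqrt (- \<kappa>'))"
  proof (rule DERIV_neg_imp_decreasing[where f = G])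
    fix k assume "sqrt (- \<kappa>') \<le> k"
    moreover have "0 < sqrt (- \<kappa>')" using assms by simp
    ultimately have k: "0 < k" by linarith
    let ?c = "\<lambda>t. cosh (k * t) / sinh (k * t)"
    let ?D = "x * ?c x + y * ?c y - (x + y + z) * ?c (x + y + z) - z * ?c z"
    have "(G has_real_derivative ?D) (at k)"
      unfolding G_def using k xyz by (intro derivative_intros deriv) auto
    moreover have "k * ?D < 0"
      using coth_superadditive[of "k * x" "k * y" "k * z"] k xyz
      by (simp add: algebra_simps)
    then have "?D < 0" using k by (simp add: mult_less_0_iff)
    ultimately show "\<exists>D. (G has_real_derivative D) (at k) \<and> D < 0" by blast
  qed (use assms in simp)
  moreover have "tan_half_sq k x y z = exp (G (sqrt (- k)))" if "k < 0" for k
    using that xyz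
    by (simp add: tan_half_sq_def sn_def G_def L_def exp_add exp_diff)
  ultimately show ?thesis using assms by simp
qed

text \<open>
  The two open half-lines of curvatures are joined by continuity at \<open>0\<close>.
\<close>

lemma tan_half_sq_less:
  assumes "\<kappa> < \<kappa>'" "\<kappa>' * (x + y + z)\<^sup>2 < pi\<^sup>2"
  shows "tan_half_sq \<kappa> x y z < tan_half_sq \<kappa>' x y z"
proof -
  let ?T = "\<lambda>k. tan_half_sq k x y z"
  have "isCont ?T 0"
    unfolding tan_half_sq_def using xyz by (intro continuous_intros isCont_sn) (auto simp: sn_def)
  then have lim: "(?T \<longlongrightarrow> ?T 0) (at_right 0)" "(?T \<longlongrightarrow> ?T 0) (at_left 0)"
    by (simp_all add: isCont_def filterlim_at_split)
  have right: "?T 0 < ?T k" if "0 < k" "k \<le> \<kappa>'" for k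
  proof -
    have *: "?T j < ?T l" if "0 < j" "j < l" "l \<le> k" for j l
      using tan_half_sq_less_positive[of j l] size_bound_mono[OF assms(2) _ order_refl, of l] that \<open>k \<le> \<kappa>'\<close> xyz
      by simp
    have "?T 0 \<le> ?T (k / 2)"
      using that by (intro tendsto_upperbound[OF lim(1)] eventually_at_rightI[of 0 "k / 2"])
        (auto intro!: less_imp_le *)
    also have "\<dots> < ?T k" using that by (intro *) auto
    finally show ?thesis .
  qed
  have left: "?T k < ?T 0" if "k < 0" for k
  proof -
    have "?T k < ?T (k / 2)" using that by (intro tan_half_sq_less_negative) auto
    also have "\<dots> \<le> ?T 0"
      using that by (intro tendsto_lowerbound[OF lim(2)] eventually_at_leftI[of "k / 2" 0])
        (auto intro!: less_imp_le tan_half_sq_less_negative)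
    finally show ?thesis .
  qed
  consider "0 < \<kappa>" | "\<kappa>' < 0" | "\<kappa> = 0" | "\<kappa>' = 0" | "\<kappa> < 0" "0 < \<kappa>'" using assms by linarith
  then show ?thesis
    using tan_half_sq_less_positive tan_half_sq_less_negative assms left[of \<kappa>] right[of \<kappa>']
    by cases auto
qed

end

text \<open>
  The cosine is \<open>(1 - T) / (1 + T)\<close> for \<open>T = tan_half_sq \<kappa> x y z\<close>, and this is decreasing in \<open>T\<close>.
\<close>

lemma model_cos_strict_antimono:
  assumes "has_triangle \<kappa>' u v w" "\<kappa> < \<kappa>'" "\<bar>u - v\<bar> < w" "w < u + v"
  shows "model_cos \<kappa>' u v w < model_cos \<kappa> u v w"
proof -
  obtain x y z where h: "u = y + z" "v = x + z" "w = x + y" and small: "\<kappa>' * (x + y + z)\<^sup>2 < pi\<^sup>2"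
    using has_triangleE[OF assms(1)] by metis
  have xyz: "x > 0" "y > 0" "z > 0" using assms h by auto
  have *: "-1 < model_cos k u v w \<and>
    tan_half_sq k x y z = (1 - model_cos k u v w) / (1 + model_cos k u v w)" if "k \<le> \<kappa>'" for k
  proof -
    have pos: "sn k t > 0" if "0 < t" "t \<le> x + y + z" for t
      using sn_pos[of t k] size_bound_mono[OF small, of t k] that \<open>k \<le> \<kappa>'\<close> by simp
    have n: "sn k (y + z) > 0" "sn k (x + z) > 0" "sn k (x + y + z) > 0" "sn k z > 0"
      using xyz by (auto intro!: pos)
    have n': "sn k (y + z) \<noteq> 0" "sn k (x + z) \<noteq> 0" using n by auto
    have "0 < 1 + model_cos k u v w"
      unfolding h one_plus_model_cos[OF n'] using n by simp
    moreover have "tan_half_sq k x y z = (1 - model_cos k u v w) / (1 + model_cos k u v w)"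
      unfolding h one_plus_model_cos[OF n'] one_minus_model_cos[OF n'] tan_half_sq_def
      using n by (simp add: field_simps)
    ultimately show ?thesis by simp
  qed
  show ?thesis
    using tan_half_sq_less[OF xyz assms(2) small] *[of \<kappa>] *[of \<kappa>'] assms(2)
    by (simp add: divide_simps split: if_splits) (simp add: algebra_simps)
qed

lemma model_cos_antimono:
  assumes "has_triangle \<kappa>' u v w" "\<kappa> \<le> \<kappa>'"
  shows "model_cos \<kappa>' u v w \<le> model_cos \<kappa> u v w"
proof -
  have t: "has_triangle \<kappa> u v w" using has_triangle_antimono[OF assms] .
  have b: "\<bar>u - v\<bar> \<le> w" "w \<le> u + v" "0 \<le> u" "0 \<le> v" using t by (auto simp: has_triangle_def)
  consider "\<kappa> = \<kappa>'" | "u = 0 \<or> v = 0" | "u > 0" "v > 0" "w = \<bar>u - v\<bar>" | "u > 0" "v > 0" "w = u + v"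
    | "\<kappa> < \<kappa>'" "\<bar>u - v\<bar> < w" "w < u + v"
    using b assms by linarith
  then show ?thesis
  proof cases
    case 2
    then show ?thesis by (auto simp: model_cos_def)
  next
    case 3
    then show ?thesis using model_cos_eq_1_iff[OF t] model_cos_eq_1_iff[OF assms(1)] by simp
  next
    case 4
    then show ?thesis
      using model_cos_eq_minus_1_iff[OF t] model_cos_eq_minus_1_iff[OF assms(1)] by simp
  next
    case 5
    then show ?thesis using model_cos_strict_antimono[OF assms(1)] by (simp add: less_imp_le)
  qed simp
qed

section \<open>Alexandrov's lemma and the choice of the curvature\<close>

text \<open>
  Here \<open>x\<close> divides the side \<open>qs\<close> of length \<open>b + d\<close>. Substituting the law of cosines in all four places
  expresses both sides through the versed sines of \<open>a\<close>, \<open>m\<close> and \<open>c\<close>, and the addition formulas for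
  \<open>sn \<kappa> (b + d)\<close> and \<open>md \<kappa> (b + d)\<close> make the coefficients agree. In curvature \<open>0\<close> this is Stewart's
  theorem with a defect term for a broken line at \<open>x\<close>.
\<close>

lemma alexandrov_identity:
  assumes "sn \<kappa> a \<noteq> 0" "sn \<kappa> b \<noteq> 0" "sn \<kappa> m \<noteq> 0" "sn \<kappa> d \<noteq> 0" "sn \<kappa> (b + d) \<noteq> 0"
  shows "sn \<kappa> a * sn \<kappa> (b + d) * (model_cos \<kappa> a (b + d) c - model_cos \<kappa> a b m) =
         sn \<kappa> d * sn \<kappa> m * (model_cos \<kappa> m b a + model_cos \<kappa> m d c)"
proof -
  have e: "model_cos \<kappa> u v w * (sn \<kappa> u * sn \<kappa> v) = md \<kappa> u + md \<kappa> v - md \<kappa> w - \<kappa> * md \<kappa> u * md \<kappa> v"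
    if "sn \<kappa> u \<noteq> 0" "sn \<kappa> v \<noteq> 0" for u v w
    using that by (simp add: model_cos_def)
  \<comment> \<open>The factor \<open>sn \<kappa> b\<close> clears the remaining denominators.\<close>
  have "sn \<kappa> b * (sn \<kappa> a * sn \<kappa> (b + d) * (model_cos \<kappa> a (b + d) c - model_cos \<kappa> a b m)) =
        sn \<kappa> b * (model_cos \<kappa> a (b + d) c * (sn \<kappa> a * sn \<kappa> (b + d))) -
        sn \<kappa> (b + d) * (model_cos \<kappa> a b m * (sn \<kappa> a * sn \<kappa> b))"
    by (simp add: algebra_simps)
  also have "\<dots> = sn \<kappa> d * (model_cos \<kappa> m b a * (sn \<kappa> m * sn \<kappa> b)) +
                  sn \<kappa> b * (model_cos \<kappa> m d c * (sn \<kappa> m * sn \<kappa> d))"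
    unfolding e[OF assms(1,5)] e[OF assms(1,2)] e[OF assms(3,2)] e[OF assms(3,4)]
    using sn_squared[of \<kappa> b] sn_squared[of \<kappa> d]
    unfolding md_add sn_add cs_eq_md by algebra
  also have "\<dots> = sn \<kappa> b * (sn \<kappa> d * sn \<kappa> m * (model_cos \<kappa> m b a + model_cos \<kappa> m d c))"
    by (simp add: algebra_simps)
  finally show ?thesis using assms(2) by simp
qed

lemma sn_side_pos:
  assumes "has_triangle \<kappa> u v w" "t \<in> {u, v, w}" "t > 0"
  shows "sn \<kappa> t > 0"
  using assms size_bound_mono[of \<kappa> "(u + v + w) / 2" t \<kappa>]
  by (intro sn_pos) (auto simp: has_triangle_def)

lemma has_triangle_swap: "has_triangle \<kappa> u v w \<Longrightarrow> has_triangle \<kappa> w v u"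
  by (simp add: has_triangle_def algebra_simps)

lemma alexandrov_lemma:
  assumes "has_triangle \<kappa> a b m" "has_triangle \<kappa> m d c" "has_triangle \<kappa> a (b + d) c"
    and "a > 0" "b > 0" "m > 0" "d > 0"
  shows "0 \<le> model_cos \<kappa> m b a + model_cos \<kappa> m d c \<Longrightarrow>
           model_cos \<kappa> a b m \<le> model_cos \<kappa> a (b + d) c"
    and "0 < model_cos \<kappa> m b a + model_cos \<kappa> m d c \<Longrightarrow>
           model_cos \<kappa> a b m < model_cos \<kappa> a (b + d) c"
proof -
  have pos: "sn \<kappa> a > 0" "sn \<kappa> b > 0" "sn \<kappa> m > 0" "sn \<kappa> d > 0" "sn \<kappa> (b + d) > 0"
    using sn_side_pos[OF assms(1)] sn_side_pos[OF assms(2)] sn_side_pos[OF assms(3)] assms(4-) by auto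
  let ?S = "model_cos \<kappa> m b a + model_cos \<kappa> m d c"
  let ?D = "model_cos \<kappa> a (b + d) c - model_cos \<kappa> a b m"
  have e: "(sn \<kappa> a * sn \<kappa> (b + d)) * ?D = (sn \<kappa> d * sn \<kappa> m) * ?S"
    using pos by (intro alexandrov_identity) auto
  have p: "sn \<kappa> a * sn \<kappa> (b + d) > 0" "sn \<kappa> d * sn \<kappa> m > 0"
    using pos by auto
  have "0 \<le> ?S \<Longrightarrow> 0 \<le> ?D" "0 < ?S \<Longrightarrow> 0 < ?D"
    using p e by (metis mult_nonneg_nonneg less_imp_le zero_le_mult_iff not_less,
      metis mult_pos_pos zero_less_mult_pos)
  then show "0 \<le> ?S \<Longrightarrow> model_cos \<kappa> a b m \<le> model_cos \<kappa> a (b + d) c"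
    "0 < ?S \<Longrightarrow> model_cos \<kappa> a b m < model_cos \<kappa> a (b + d) c"
    by auto
qed

definition degenerate :: "real \<Rightarrow> real \<Rightarrow> real \<Rightarrow> bool" where
  "degenerate u v w \<longleftrightarrow> w = \<bar>u - v\<bar> \<or> w = u + v"

text \<open>
  If the two angles at \<open>x\<close> add up to \<open>pi\<close> and one of them is \<open>0\<close> or \<open>pi\<close>, then the other one is \<open>pi\<close> or
  \<open>0\<close>, and the four points have the distances of points on a line.
\<close>

lemma degenerate_if_halves_degenerate:
  assumes "has_triangle \<kappa>\<^sub>1 m b a" "has_triangle \<kappa>\<^sub>2 m d c" "m > 0" "b > 0" "d > 0"
    and sum: "model_cos \<kappa>\<^sub>1 m b a + model_cos \<kappa>\<^sub>2 m d c = 0"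
    and deg: "degenerate m b a \<or> degenerate m d c"
  shows "degenerate a (b + d) c"
proof -
  note iff1 = model_cos_eq_1_iff[OF assms(1)] model_cos_eq_minus_1_iff[OF assms(1)]
  note iff2 = model_cos_eq_1_iff[OF assms(2)] model_cos_eq_minus_1_iff[OF assms(2)]
  have "model_cos \<kappa>\<^sub>1 m b a = 1 \<and> model_cos \<kappa>\<^sub>2 m d c = -1 \<or>
        model_cos \<kappa>\<^sub>1 m b a = -1 \<and> model_cos \<kappa>\<^sub>2 m d c = 1"
    using deg sum iff1 iff2 assms(3-5) unfolding degenerate_def by fastforce
  then have "a = \<bar>m - b\<bar> \<and> c = m + d \<or> a = m + b \<and> c = \<bar>m - d\<bar>"
    using iff1 iff2 assms(3-5) by auto
  then show ?thesis using assms(3-5) unfolding degenerate_def by arith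
qed

text \<open>
  Passing to the smaller curvature changes only one of the two triangles at \<open>x\<close>. If the sum of the
  cosines vanishes beforehand, then that triangle is nondegenerate, because otherwise the whole
  configuration would be degenerate, so the change makes its cosine strictly larger.
\<close>

lemma cos_sum_pos:
  assumes "has_triangle (max \<kappa>\<^sub>1 \<kappa>\<^sub>2) m b a" "has_triangle (max \<kappa>\<^sub>1 \<kappa>\<^sub>2) m d c" "m > 0" "b > 0" "d > 0"
    and "\<kappa>\<^sub>1 \<noteq> \<kappa>\<^sub>2" "\<not> degenerate a (b + d) c"
    and sum: "0 \<le> model_cos \<kappa>\<^sub>1 m b a + model_cos \<kappa>\<^sub>2 m d c"
  shows "0 < model_cos (min \<kappa>\<^sub>1 \<kappa>\<^sub>2) m b a + model_cos (min \<kappa>\<^sub>1 \<kappa>\<^sub>2) m d c"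
proof -
  have t: "has_triangle k m b a" "has_triangle k m d c" if "k \<le> max \<kappa>\<^sub>1 \<kappa>\<^sub>2" for k
    using has_triangle_antimono[OF assms(1) that] has_triangle_antimono[OF assms(2) that] by auto
  have t1: "has_triangle \<kappa>\<^sub>1 m b a" "has_triangle \<kappa>\<^sub>2 m d c" using t by auto
  have le: "model_cos \<kappa>\<^sub>1 m b a \<le> model_cos (min \<kappa>\<^sub>1 \<kappa>\<^sub>2) m b a"
    "model_cos \<kappa>\<^sub>2 m d c \<le> model_cos (min \<kappa>\<^sub>1 \<kappa>\<^sub>2) m d c"
    using t1 by (auto intro!: model_cos_antimono)
  show ?thesis
  proof (cases "0 < model_cos \<kappa>\<^sub>1 m b a + model_cos \<kappa>\<^sub>2 m d c")
    case True
    then show ?thesis using le by simp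
  next
    case False
    then have "model_cos \<kappa>\<^sub>1 m b a + model_cos \<kappa>\<^sub>2 m d c = 0" using sum by simp
    then have nd: "\<not> degenerate m b a" "\<not> degenerate m d c"
      using degenerate_if_halves_degenerate[OF t1 assms(3-5)] assms(7) by auto
    have str: "\<bar>m - b\<bar> < a" "a < m + b" "\<bar>m - d\<bar> < c" "c < m + d"
      using nd t1 unfolding degenerate_def has_triangle_def by linarith+
    show ?thesis
    proof (cases "\<kappa>\<^sub>1 < \<kappa>\<^sub>2")
      case True
      then have "model_cos \<kappa>\<^sub>2 m d c < model_cos \<kappa>\<^sub>1 m d c"
        using t1 str by (intro model_cos_strict_antimono) auto
      then show ?thesis using True sum by (simp add: min_def)
    next
      case False
      then have "\<kappa>\<^sub>2 < \<kappa>\<^sub>1" using assms(6) by simp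
      moreover from this have "model_cos \<kappa>\<^sub>1 m b a < model_cos \<kappa>\<^sub>2 m b a"
        using t1 str by (intro model_cos_strict_antimono) auto
      ultimately show ?thesis using sum by (simp add: min_def)
    qed
  qed
qed

text \<open>
  The smaller of the two curvatures can be either endpoint, so the parameter \<open>t\<close> is close to \<open>0\<close> or
  close to \<open>1\<close>.
\<close>

lemma open_segment_near_min:
  fixes \<kappa>\<^sub>1 \<kappa>\<^sub>2 :: real
  assumes "\<kappa>\<^sub>1 \<noteq> \<kappa>\<^sub>2" "eventually P (at (min \<kappa>\<^sub>1 \<kappa>\<^sub>2))"
  shows "\<exists>t\<in>{0<..<1}. P ((1 - t) * \<kappa>\<^sub>1 + t * \<kappa>\<^sub>2)"
proof -
  have "eventually P (at_right (min \<kappa>\<^sub>1 \<kappa>\<^sub>2))"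
    using assms(2) by (simp add: eventually_at_split)
  moreover have "\<forall>\<^sub>F k in at_right (min \<kappa>\<^sub>1 \<kappa>\<^sub>2). k \<in> {min \<kappa>\<^sub>1 \<kappa>\<^sub>2<..<max \<kappa>\<^sub>1 \<kappa>\<^sub>2}"
    using assms(1) by (intro eventually_at_rightI[of _ "max \<kappa>\<^sub>1 \<kappa>\<^sub>2"]) auto
  ultimately have "\<forall>\<^sub>F k in at_right (min \<kappa>\<^sub>1 \<kappa>\<^sub>2). P k \<and> k \<in> {min \<kappa>\<^sub>1 \<kappa>\<^sub>2<..<max \<kappa>\<^sub>1 \<kappa>\<^sub>2}"
    by (rule eventually_conj)
  then obtain k where k: "P k" "min \<kappa>\<^sub>1 \<kappa>\<^sub>2 < k" "k < max \<kappa>\<^sub>1 \<kappa>\<^sub>2"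
    using eventually_happens'[OF trivial_limit_at_right_real] by fastforce
  have "k \<in> open_segment \<kappa>\<^sub>1 \<kappa>\<^sub>2"
    using k assms(1) by (auto simp: open_segment_eq_real_ivl min_def max_def split: if_splits)
  then show ?thesis using k(1) by (auto simp: in_segment)
qed

text \<open>
  The triangle conditions are imposed for the larger curvature only: they then hold for all smaller
  ones.
\<close>

lemma exists_intermediate_curvature:
  assumes triangles: "has_triangle (max \<kappa>\<^sub>1 \<kappa>\<^sub>2) a b m" "has_triangle (max \<kappa>\<^sub>1 \<kappa>\<^sub>2) m d c"
      "has_triangle (max \<kappa>\<^sub>1 \<kappa>\<^sub>2) a (b + d) c"
    and pos: "a > 0" "b > 0" "m > 0" "d > 0"
    and sum: "0 \<le> model_cos \<kappa>\<^sub>1 m b a + model_cos \<kappa>\<^sub>2 m d c"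
  shows "\<exists>t\<in>{0<..<1}. model_cos \<kappa>\<^sub>1 a b m \<le> model_cos ((1 - t) * \<kappa>\<^sub>1 + t * \<kappa>\<^sub>2) a (b + d) c"
proof -
  define \<kappa> where "\<kappa> = min \<kappa>\<^sub>1 \<kappa>\<^sub>2"
  have \<kappa>: "\<kappa> \<le> \<kappa>\<^sub>1" "\<kappa> \<le> \<kappa>\<^sub>2" by (auto simp: \<kappa>_def)
  have tri: "has_triangle k a b m" "has_triangle k m b a" "has_triangle k m d c"
    "has_triangle k a (b + d) c" if "k \<le> max \<kappa>\<^sub>1 \<kappa>\<^sub>2" for k
    using triangles[THEN has_triangle_antimono[OF _ that]] has_triangle_swap by auto
  have kM: "\<kappa> \<le> max \<kappa>\<^sub>1 \<kappa>\<^sub>2" by (simp add: \<kappa>_def)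
  note alex = alexandrov_lemma[OF tri(1,3,4) pos, of \<kappa>]
  have q: "model_cos \<kappa>\<^sub>1 a b m \<le> model_cos \<kappa> a b m"
    using tri \<kappa> by (auto intro: model_cos_antimono)
  have "model_cos \<kappa>\<^sub>1 m b a \<le> model_cos \<kappa> m b a" "model_cos \<kappa>\<^sub>2 m d c \<le> model_cos \<kappa> m d c"
    using tri \<kappa> by (auto intro!: model_cos_antimono)
  then have weak: "model_cos \<kappa>\<^sub>1 a b m \<le> model_cos \<kappa> a (b + d) c"
    using alex(1) sum q \<kappa> by linarith
  have bd: "b + d > 0" using pos by simp
  show ?thesis
  proof (cases "\<kappa>\<^sub>1 = \<kappa>\<^sub>2 \<or> degenerate a (b + d) c")
    case True
    let ?k = "(1 - 1 / 2) * \<kappa>\<^sub>1 + 1 / 2 * \<kappa>\<^sub>2"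
    have k: "?k \<le> max \<kappa>\<^sub>1 \<kappa>\<^sub>2" "\<kappa> \<le> max \<kappa>\<^sub>1 \<kappa>\<^sub>2" by (auto simp: \<kappa>_def)
    have "model_cos ?k a (b + d) c = model_cos \<kappa> a (b + d) c"
    proof (cases "\<kappa>\<^sub>1 = \<kappa>\<^sub>2")
      case True
      then show ?thesis by (simp add: \<kappa>_def)
    next
      case False
      then show ?thesis
        using True model_cos_eq_1_iff[OF tri(4)[OF k(1)] pos(1) bd]
          model_cos_eq_1_iff[OF tri(4)[OF k(2)] pos(1) bd]
          model_cos_eq_minus_1_iff[OF tri(4)[OF k(1)] pos(1) bd]
          model_cos_eq_minus_1_iff[OF tri(4)[OF k(2)] pos(1) bd]
        unfolding degenerate_def by metis
    qed
    then show ?thesis using weak by (intro bexI[of _ "1 / 2"]) auto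
  next
    case False
    then have ne: "\<kappa>\<^sub>1 \<noteq> \<kappa>\<^sub>2" and nd: "\<not> degenerate a (b + d) c" by auto
    have "0 < model_cos \<kappa> m b a + model_cos \<kappa> m d c"
      unfolding \<kappa>_def using tri pos ne nd sum by (intro cos_sum_pos) auto
    then have strict: "model_cos \<kappa>\<^sub>1 a b m < model_cos \<kappa> a (b + d) c"
      using alex(2) q \<kappa> by fastforce
    have "isCont (\<lambda>k. model_cos k a (b + d) c) \<kappa>"
      using sn_side_pos[OF tri(4)[OF kM], of a] sn_side_pos[OF tri(4)[OF kM], of "b + d"] pos bd
      by (intro isCont_model_cos) auto
    then have "\<forall>\<^sub>F k in at \<kappa>. model_cos \<kappa>\<^sub>1 a b m < model_cos k a (b + d) c"
      unfolding isCont_def using strict by (rule order_tendstoD)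
    then show ?thesis
      using open_segment_near_min[OF ne, folded \<kappa>_def] by (metis (mono_tags, lifting) less_imp_le)
  qed
qed

theorem lemma1p2:
  fixes p q s x :: "'a::metric_space"
    and g :: "real \<Rightarrow> 'a"
    and b d \<kappa>\<^sub>1 \<kappa>\<^sub>2 :: real
  assumes "length_space TYPE('a)"
    and "minimal_geodesic g q s"
    and "x \<in> path_image g - {q, s}"
    and "dist q x = b" and "dist x s = d"
    and "\<And>\<kappa> T. \<kappa> \<in> {\<kappa>\<^sub>1, \<kappa>\<^sub>2} \<Longrightarrow> \<kappa> > 0 \<Longrightarrow> T \<in> {{p, q, x}, {p, x, s}, {p, q, s}} \<Longrightarrow>
           in_small_ball \<kappa> T"
    and "comparison_angle \<kappa>\<^sub>1 x p q + comparison_angle \<kappa>\<^sub>2 x p s \<le> pi"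
  shows "\<exists>t\<in>{0<..<1}. comparison_angle \<kappa>\<^sub>1 q p x
           \<ge> comparison_angle ((1 - t) * \<kappa>\<^sub>1 + t * \<kappa>\<^sub>2) q p s"
proof -
  define a m c where "a = dist q p" and "m = dist x p" and "c = dist p s"
  have qs: "dist q s = b + d"
    using dist_add_of_minimal_geodesic[OF assms(2)] assms(3-5) by auto
  have bd: "b > 0" "d > 0" using assms(3-5) by auto
  have small: "in_small_ball \<kappa> T"
    if "\<kappa> = max \<kappa>\<^sub>1 \<kappa>\<^sub>2" "\<kappa> > 0" "T \<in> {{p, q, x}, {p, x, s}, {p, q, s}}" for \<kappa> T
    using assms(6)[of \<kappa> T] that by (auto simp: max_def)
  have max: "has_triangle (max \<kappa>\<^sub>1 \<kappa>\<^sub>2) a b m" "has_triangle (max \<kappa>\<^sub>1 \<kappa>\<^sub>2) m d c"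
    "has_triangle (max \<kappa>\<^sub>1 \<kappa>\<^sub>2) a (b + d) c"
    using has_triangle_if_in_small_ball[of "max \<kappa>\<^sub>1 \<kappa>\<^sub>2" p q x]
      has_triangle_if_in_small_ball[of "max \<kappa>\<^sub>1 \<kappa>\<^sub>2" p x s]
      has_triangle_if_in_small_ball[of "max \<kappa>\<^sub>1 \<kappa>\<^sub>2" p q s] small
    by (auto simp: a_def m_def c_def qs assms(4,5) dist_commute[of p x])
  have tri: "has_triangle k a b m" "has_triangle k m b a" "has_triangle k m d c"
    "has_triangle k a (b + d) c" if "k \<le> max \<kappa>\<^sub>1 \<kappa>\<^sub>2" for k
    using max[THEN has_triangle_antimono[OF _ that]] has_triangle_swap by auto
  have "comparison_angle k x p q = arccos (model_cos k m b a)"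
    "comparison_angle k x p s = arccos (model_cos k m d c)"
    "comparison_angle k q p x = arccos (model_cos k a b m)"
    "comparison_angle k q p s = arccos (model_cos k a (b + d) c)" if "k \<le> max \<kappa>\<^sub>1 \<kappa>\<^sub>2" for k
    using comparison_angle_eq[of k x p q] comparison_angle_eq[of k x p s]
      comparison_angle_eq[of k q p x] comparison_angle_eq[of k q p s] tri[OF that] assms(4,5)
    by (simp_all add: a_def m_def c_def qs dist_commute)
  note angle = this
  have seg: "(1 - t) * \<kappa>\<^sub>1 + t * \<kappa>\<^sub>2 \<le> max \<kappa>\<^sub>1 \<kappa>\<^sub>2" if "t \<in> {0<..<1}" for t
    using that by (intro convex_bound_le) auto
  have arccos: "arccos (model_cos k u v w) \<le> arccos (model_cos l u' v' w')"
    if "model_cos l u' v' w' \<le> model_cos k u v w" "has_triangle k u v w" "has_triangle l u' v' w'"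
    for k l u v w u' v' w'
    using that model_cos_le_1 model_cos_ge_minus_1 by (auto intro!: arccos_le_arccos)
  \<comment> \<open>Arc cosine reverses the order, so only an inequality between cosines has to be proved.\<close>
  have reduce: ?thesis
    if "\<exists>t\<in>{0<..<1}. model_cos \<kappa>\<^sub>1 a b m \<le> model_cos ((1 - t) * \<kappa>\<^sub>1 + t * \<kappa>\<^sub>2) a (b + d) c"
    using that angle seg tri arccos by (metis max.cobounded1)
  consider "p = q" | "p \<noteq> q" "p = x" | "p \<noteq> q" "p \<noteq> x" by blast
  then show ?thesis
  proof cases
    case 1
    \<comment> \<open>Both angles at \<open>q\<close> have the value \<open>pi / 2\<close> of an angle with a vanishing side.\<close>
    then have "a = 0" by (simp add: a_def)
    then show ?thesis by (intro reduce bexI[of _ "1 / 2"]) (auto simp: model_cos_def)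
  next
    case 2
    \<comment> \<open>The point \<open>p = x\<close> lies between \<open>q\<close> and \<open>s\<close>, so the angle of the large triangle at \<open>q\<close> is \<open>0\<close>.\<close>
    then have "a = b" "c = d" using assms(4,5) by (auto simp: a_def c_def)
    then have "model_cos k a (b + d) c = 1" if "k \<le> max \<kappa>\<^sub>1 \<kappa>\<^sub>2" for k
      using model_cos_eq_1_iff[OF tri(4)[OF that]] bd by simp
    then show ?thesis
      using model_cos_le_1[OF tri(1), of \<kappa>\<^sub>1] seg[of "1 / 2"] by (intro reduce bexI[of _ "1 / 2"]) auto
  next
    case 3
    have "arccos (model_cos \<kappa>\<^sub>1 m b a) \<le> pi - arccos (model_cos \<kappa>\<^sub>2 m d c)"
      using assms(7) angle by simp
    also have "\<dots> = arccos (- model_cos \<kappa>\<^sub>2 m d c)"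
      using tri(3)[of \<kappa>\<^sub>2] by (simp add: arccos_minus model_cos_le_1 model_cos_ge_minus_1)
    finally have "- model_cos \<kappa>\<^sub>2 m d c \<le> model_cos \<kappa>\<^sub>1 m b a"
      using tri(2)[of \<kappa>\<^sub>1] tri(3)[of \<kappa>\<^sub>2] model_cos_le_1 model_cos_ge_minus_1
      by (subst (asm) arccos_le_mono) (auto simp: abs_le_iff minus_le_iff)
    then have "0 \<le> model_cos \<kappa>\<^sub>1 m b a + model_cos \<kappa>\<^sub>2 m d c" by simp
    then show ?thesis
      using 3 max bd by (intro reduce exists_intermediate_curvature) (auto simp: a_def m_def)
  qed
qed

end
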